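(* Let $a\ge1$. Then: (1) For any two permutations $\nu,\nu'$ of $[a]$, $\mathcal{T}_\nu$ and $\mathcal{T}_{\nu'}$ acting on $J(\mathcal{L}_a)$ have the same orbit structure (the same multiset of orbit sizes). (2) For $1\le j\le a$ let $s_j(I)=\#\{i\in[a]: |C_i(I)|=j\}$. For every permutation $\nu$ of $[a]$ and every $1\le j\le a$, $s_j$ is homomesic for $\mathcal{T}_\nu$ on $J(\mathcal{L}_a)$, and its average along every orbit is the same for all $j$ (namely $1/2$). Consequently every real linear combination of the $s_j$ is homomesic for $\mathcal{T}_\nu$ on $J(\mathcal{L}_a)$.
   Context: For a finite poset $P$, $J(P)$ is the set of order ideals (down-closed subsets) of $P$. For $x\in P$, the toggle $\sigma_x:J(P)\to J(P)$ is $\sigma_x(I)=I\cup\{x\}$ if $x\notin I$ and $I\cup\{x\}\in J(P)$; $\sigma_x(I)=I\setminus\{x\}$ if $x\in I$ and $I\setminus\{x\}\in J(P)$; $\sigma_x(I)=I$ otherwise. For a chain $C=\{x_1<\dots<x_m\}$ in $P$, $\sigma_C=\sigma_{x_1}\circ\cdots\circ\sigma_{x_m}$ (largest element toggled first). $\mathcal{L}_a=\{(i,j)\in[a]\times[a]: i\le j\}$ with the order $(i_1,j_1)\le(i_2,j_2)$ iff $i_1\le i_2$ and $j_1\le j_2$; its columns are $C_c=\{(c,j): c\le j\le a\}$ for $c\in[a]$, and $C_c(I)=C_c\cap I$. For a permutation $\nu$ of $[a]$, comotion is $\mathcal{T}_\nu=\sigma_{C_{\nu(a)}}\circ\cdots\circ\sigma_{C_{\nu(1)}}$.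 A function $f$ on a finite set with a permutation $\tau$ is homomesic if its average over every $\tau$-orbit is the same constant. *)

theory Defs
  imports Complex_Main "HOL-Library.Multiset" "HOL-Combinatorics.Permutations"
begin

definition order_ideal :: "'a set \<Rightarrow> ('a \<Rightarrow> 'a \<Rightarrow> bool) \<Rightarrow> 'a set \<Rightarrow> bool" where
  "order_ideal P le I \<longleftrightarrow> I \<subseteq> P \<and> (\<forall>x\<in>I. \<forall>y\<in>P. le y x \<longrightarrow> y \<in> I)"

definition ideals :: "'a set \<Rightarrow> ('a \<Rightarrow> 'a \<Rightarrow> bool) \<Rightarrow> 'a set set" where
  "ideals P le = {I. order_ideal P le I}"

definition toggle :: "'a set \<Rightarrow> ('a \<Rightarrow> 'a \<Rightarrow> bool) \<Rightarrow> 'a \<Rightarrow> 'a set \<Rightarrow> 'a set" where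
  "toggle P le x I =
     (if x \<notin> I \<and> order_ideal P le (insert x I) then insert x I
      else if x \<in> I \<and> order_ideal P le (I - {x}) then I - {x}
      else I)"

text \<open>Toggling along a chain given as the increasing list [x1,...,xm]:
  sigma_x1 o ... o sigma_xm (largest element toggled first).\<close>
definition chain_toggle :: "'a set \<Rightarrow> ('a \<Rightarrow> 'a \<Rightarrow> bool) \<Rightarrow> 'a list \<Rightarrow> 'a set \<Rightarrow> 'a set" where
  "chain_toggle P le xs = foldr (\<lambda>x f. toggle P le x \<circ> f) xs id"

definition La :: "nat \<Rightarrow> (nat \<times> nat) set" where
  "La a = {(i, j). 1 \<le> i \<and> i \<le> j \<and> j \<le> a}"

definition Lle :: "nat \<times> nat \<Rightarrow> nat \<times> nat \<Rightarrow> bool" where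
  "Lle p q \<longleftrightarrow> fst p \<le> fst q \<and> snd p \<le> snd q"

definition JL :: "nat \<Rightarrow> (nat \<times> nat) set set" where
  "JL a = ideals (La a) Lle"

definition column :: "nat \<Rightarrow> nat \<Rightarrow> (nat \<times> nat) set" where
  "column a c = {(c, j) | j. c \<le> j \<and> j \<le> a}"

definition column_list :: "nat \<Rightarrow> nat \<Rightarrow> (nat \<times> nat) list" where
  "column_list a c = map (\<lambda>j. (c, j)) [c..<Suc a]"

definition col_toggle :: "nat \<Rightarrow> nat \<Rightarrow> (nat \<times> nat) set \<Rightarrow> (nat \<times> nat) set" where
  "col_toggle a c = chain_toggle (La a) Lle (column_list a c)"

definition comotion :: "nat \<Rightarrow> (nat \<Rightarrow> nat) \<Rightarrow> (nat \<times> nat) set \<Rightarrow> (nat \<times> nat) set" where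
  "comotion a \<nu> = foldr (\<lambda>k f. col_toggle a (\<nu> k) \<circ> f) (rev [1..<Suc a]) id"

definition orbit_of :: "('b \<Rightarrow> 'b) \<Rightarrow> 'b \<Rightarrow> 'b set" where
  "orbit_of f x = {(f ^^ n) x | n. True}"

definition orbit_structure :: "'b set \<Rightarrow> ('b \<Rightarrow> 'b) \<Rightarrow> nat multiset" where
  "orbit_structure S f = image_mset card (mset_set (orbit_of f ` S))"

definition orbit_average :: "('b \<Rightarrow> 'b) \<Rightarrow> ('b \<Rightarrow> real) \<Rightarrow> 'b \<Rightarrow> real" where
  "orbit_average f g x = (\<Sum>y\<in>orbit_of f x. g y) / real (card (orbit_of f x))"

definition homomesic :: "'b set \<Rightarrow> ('b \<Rightarrow> 'b) \<Rightarrow> ('b \<Rightarrow> real) \<Rightarrow> bool" where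
  "homomesic S f g \<longleftrightarrow> (\<exists>c. \<forall>x\<in>S. orbit_average f g x = c)"

definition s_stat :: "nat \<Rightarrow> nat \<Rightarrow> (nat \<times> nat) set \<Rightarrow> real" where
  "s_stat a j I = real (card {i \<in> {1..a}. card (column a i \<inter> I) = j})"

end

theory Submission
  imports Defs
begin

text \<open>The column sizes of an order ideal form a strict partition with parts at most \<open>a\<close>, and
  \<open>s\<^sub>j\<close> indicates whether \<open>j\<close> is a part. Toggling a column increases its part by 1 or, if the part
  is already maximal, resets it to the minimal admissible value. Toggling the columns from left
  to right therefore shifts the set of parts by 1, the number 1 entering exactly if \<open>a\<close> was
  absent; so on each orbit all \<open>s\<^sub>j\<close> have the same average, and it equals 1 minus itself.

  Toggles of non-neighbouring columns commute, and every order of the columns can be turned into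
  the left-to-right order by such commutations and cyclic rotations. A rotation conjugates the
  action and preserves the orbit averages, since each column is updated exactly once per round.\<close>

section \<open>Bijections and orbits\<close>

lemma finite_orbit_of:
  assumes "bij_betw f S S" "finite S" "x \<in> S"
  shows "orbit_of f x \<subseteq> S" "finite (orbit_of f x)" "orbit_of f x \<noteq> {}"
proof -
  have "(f ^^ n) x \<in> S" for n
    using assms by (induction n) (auto simp: bij_betw_def)
  then show "orbit_of f x \<subseteq> S" by (auto simp: orbit_of_def)
  then show "finite (orbit_of f x)" using assms(2) finite_subset by blast
  show "orbit_of f x \<noteq> {}" by (auto simp: orbit_of_def)
qed

text \<open>Orbits are built from forward iterates only. An injective self-map of a finite set is
  surjective, so every orbit is also closed under going back.\<close>

lemma bij_betw_orbit_of:
  assumes "bij_betw f S S" "finite S" "x \<in> S"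
  shows "bij_betw f (orbit_of f x) (orbit_of f x)"
proof -
  note fin = finite_orbit_of[OF assms]
  have sub: "f ` orbit_of f x \<subseteq> orbit_of f x"
  proof
    fix y assume "y \<in> f ` orbit_of f x"
    then obtain n where "y = f ((f ^^ n) x)" by (auto simp: orbit_of_def)
    then have "y = (f ^^ Suc n) x" by simp
    then show "y \<in> orbit_of f x" unfolding orbit_of_def by blast
  qed
  have inj: "inj_on f (orbit_of f x)"
    using assms(1) fin(1) by (auto simp: bij_betw_def intro: inj_on_subset)
  show ?thesis
    using endo_inj_surj[OF fin(2) sub inj] inj by (simp add: bij_betw_def)
qed

text \<open>Turns a pointwise relation between statistics before and after one step into a relation
  between orbit sums.\<close>

lemma sum_orbit_of_shift:
  assumes "bij_betw f S S" "finite S" "x \<in> S"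
  shows "(\<Sum>y\<in>orbit_of f x. g (f y)) = (\<Sum>y\<in>orbit_of f x. g y)"
  using sum.reindex_bij_betw[OF bij_betw_orbit_of[OF assms]] .

lemma orbit_of_conjugate:
  assumes "\<And>y. y \<in> S \<Longrightarrow> f y \<in> S" "\<And>y. y \<in> S \<Longrightarrow> g (h y) = h (f y)" "x \<in> S"
  shows "orbit_of g (h x) = h ` orbit_of f x"
proof -
  have "(f ^^ n) x \<in> S \<and> (g ^^ n) (h x) = h ((f ^^ n) x)" for n
    using assms by (induction n) auto
  then show ?thesis by (auto simp: orbit_of_def)
qed

text \<open>Taking \<open>h\<close>-images carries the orbits of \<open>f\<close> onto those of
  \<open>g\<close>. Since \<open>h\<close> is injective on \<open>S\<close>, this is one-to-one on
  orbits and preserves their sizes.\<close>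

lemma orbit_structure_conjugate:
  assumes "finite S" "\<And>y. y \<in> S \<Longrightarrow> f y \<in> S" "bij_betw h S S"
    "\<And>y. y \<in> S \<Longrightarrow> g (h y) = h (f y)"
  shows "orbit_structure S g = orbit_structure S f"
proof -
  have inj: "inj_on h S" and img: "h ` S = S"
    using assms(3) by (auto simp: bij_betw_def)
  have sub: "A \<subseteq> S" if A: "A \<in> orbit_of f ` S" for A
  proof -
    from A obtain x where x: "x \<in> S" "A = orbit_of f x" by blast
    have "(f ^^ n) x \<in> S" for n using x assms(2) by (induction n) auto
    then show ?thesis using x by (auto simp: orbit_of_def)
  qed
  have conj: "orbit_of g (h x) = h ` orbit_of f x" if "x \<in> S" for x
    using orbit_of_conjugate[of S f g h x] assms that by blast
  have "orbit_of g ` S = orbit_of g ` (h ` S)" by (simp add: img)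
  also have "\<dots> = (\<lambda>A. h ` A) ` (orbit_of f ` S)"
    using conj by (auto simp: image_iff)
  finally have orbs: "orbit_of g ` S = (\<lambda>A. h ` A) ` (orbit_of f ` S)" .
  have "inj_on (\<lambda>A. h ` A) (orbit_of f ` S)"
    using inj sub by (meson inj_onI inj_on_image_eq_iff)
  then have "mset_set (orbit_of g ` S) = image_mset (\<lambda>A. h ` A) (mset_set (orbit_of f ` S))"
    unfolding orbs by (simp add: image_mset_mset_set)
  moreover have "card (h ` A) = card A" if "A \<in> orbit_of f ` S" for A
    using card_image inj_on_subset[OF inj sub[OF that]] by blast
  ultimately show ?thesis
    using assms(1) unfolding orbit_structure_def
    by (auto simp: image_mset.compositionality intro!: image_mset_cong)
qed

section \<open>Toggles as involutions of the set of order ideals\<close>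

lemma toggle_in_ideals: "I \<in> ideals P le \<Longrightarrow> toggle P le x I \<in> ideals P le"
  by (auto simp: toggle_def ideals_def)

lemma toggle_toggle: "I \<in> ideals P le \<Longrightarrow> toggle P le x (toggle P le x I) = I"
  by (auto simp: toggle_def ideals_def insert_absorb)

lemma bij_betw_toggle: "bij_betw (toggle P le x) (ideals P le) (ideals P le)"
  by (rule bij_betw_byWitness[where f' = "toggle P le x"])
    (auto simp: toggle_toggle toggle_in_ideals)

lemma chain_toggle_Nil [simp]: "chain_toggle P le [] = id"
  by (simp add: chain_toggle_def)

lemma chain_toggle_Cons [simp]:
  "chain_toggle P le (x # xs) = toggle P le x \<circ> chain_toggle P le xs"
  by (simp add: chain_toggle_def)

lemma bij_betw_chain_toggle: "bij_betw (chain_toggle P le xs) (ideals P le) (ideals P le)"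
proof (induction xs)
  case Nil
  show ?case using bij_betw_id by (simp add: id_def)
next
  case (Cons x xs)
  then show ?case unfolding chain_toggle_Cons by (rule bij_betw_trans) (rule bij_betw_toggle)
qed

lemma bij_betw_col_toggle: "bij_betw (col_toggle a c) (JL a) (JL a)"
  unfolding col_toggle_def JL_def by (rule bij_betw_chain_toggle)

lemma finite_JL: "finite (JL a)"
proof -
  have "La a \<subseteq> {1..a} \<times> {1..a}" by (auto simp: La_def)
  then have "finite (La a)" using finite_subset by blast
  moreover have "JL a \<subseteq> Pow (La a)" by (auto simp: JL_def ideals_def order_ideal_def)
  ultimately show ?thesis by (meson finite_Pow_iff finite_subset)
qed

section \<open>Order ideals as strict partitions\<close>

text \<open>Strict partitions with parts at most \<open>a\<close>, padded with zeros. The parts are indexed from 1;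
  the value at 0 is the junk value 0.\<close>
definition strict_parts :: "nat \<Rightarrow> (nat \<Rightarrow> nat) \<Rightarrow> bool" where
  "strict_parts a m \<longleftrightarrow> m 0 = 0 \<and> (\<forall>i>a. m i = 0) \<and> m 1 \<le> a \<and>
     (\<forall>i\<ge>1. m (Suc i) = 0 \<or> m (Suc i) < m i)"

text \<open>The shifted Young diagram of the strict partition: part \<open>i\<close> is a run of
  \<open>m i\<close> cells starting at the diagonal cell \<open>(i, i)\<close>.\<close>

definition ideal_of_parts :: "(nat \<Rightarrow> nat) \<Rightarrow> (nat \<times> nat) set" where
  "ideal_of_parts m = {(i, j). 1 \<le> i \<and> i \<le> j \<and> j < i + m i}"

text \<open>The largest value part \<open>c\<close> may take while its neighbours stay fixed. After
  a zero part, truncated subtraction yields 0, as it must.\<close>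

definition part_max :: "nat \<Rightarrow> (nat \<Rightarrow> nat) \<Rightarrow> nat \<Rightarrow> nat" where
  "part_max a m c = (if c = 1 then a else m (c - 1) - 1)"

text \<open>The smallest value compatible with the next part; only zeros may repeat, hence the case
  split.\<close>

definition part_min :: "(nat \<Rightarrow> nat) \<Rightarrow> nat \<Rightarrow> nat" where
  "part_min m c = (if m (Suc c) = 0 then 0 else Suc (m (Suc c)))"

definition whirl :: "nat \<Rightarrow> (nat \<Rightarrow> nat) \<Rightarrow> nat \<Rightarrow> nat" where
  "whirl a m c = (if m c < part_max a m c then Suc (m c) else part_min m c)"

lemma strict_parts_decr:
  assumes "strict_parts a m" "1 \<le> i"
  shows "m (i + d) = 0 \<or> m (i + d) + d \<le> m i"
proof (induction d)
  case (Suc d)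
  have "m (Suc (i + d)) = 0 \<or> m (Suc (i + d)) < m (i + d)"
    using assms by (simp add: strict_parts_def)
  then show ?case using Suc by auto
qed simp

text \<open>Keeps the diagram inside the triangle: a nonempty column \<open>i\<close> ends at height
  \<open>i + m i - 1\<close>, which is thus at most \<open>a\<close>.\<close>

lemma strict_parts_bound:
  assumes "strict_parts a m" "1 \<le> i"
  shows "m i = 0 \<or> m i + i \<le> Suc a"
  using strict_parts_decr[OF assms(1), of 1 "i - 1"] assms by (auto simp: strict_parts_def)

lemma part_max_min:
  assumes "strict_parts a m" "1 \<le> c" "c \<le> a"
  shows "m c \<le> part_max a m c" "part_min m c \<le> m c"
proof -
  show "part_min m c \<le> m c"
    using assms by (auto simp: strict_parts_def part_min_def)
  show "m c \<le> part_max a m c"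
  proof (cases "c = 1")
    case False
    then obtain d where "c = Suc d" "d \<ge> 1" using assms(2) by (cases c) auto
    then show ?thesis using assms(1) by (fastforce simp: strict_parts_def part_max_def)
  qed (use assms in \<open>auto simp: strict_parts_def part_max_def\<close>)
qed

text \<open>Changing part \<open>c\<close> affects only its comparisons with the next part and with
  the previous one (with \<open>a\<close> if \<open>c = 1\<close>), which the two bounds on
  \<open>v\<close> encode.\<close>

lemma strict_parts_update:
  assumes "strict_parts a m" "1 \<le> c" "c \<le> a" "part_min m c \<le> v" "v \<le> part_max a m c"
  shows "strict_parts a (m(c := v))"
proof -
  let ?n = "m(c := v)"
  have decr: "m (Suc i) = 0 \<or> m (Suc i) < m i" if "1 \<le> i" for i
    using assms(1) that by (simp add: strict_parts_def)
  have "?n (Suc i) = 0 \<or> ?n (Suc i) < ?n i" if "1 \<le> i" for i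
  proof -
    consider "i = c" | "c = Suc i" | "i \<noteq> c" "c \<noteq> Suc i" by blast
    then show ?thesis
    proof cases
      case 1
      then show ?thesis using assms(4) by (auto simp: part_min_def split: if_splits)
    next
      case 2
      then show ?thesis using assms(5) that by (auto simp: part_max_def)
    next
      case 3
      then show ?thesis using decr[OF that] by simp
    qed
  qed
  moreover have "?n 1 \<le> a"
    using assms(1,5) by (auto simp: strict_parts_def part_max_def)
  ultimately show ?thesis
    using assms(1-3) unfolding strict_parts_def by simp
qed

text \<open>By \<open>strict_parts_decr\<close> the column ends \<open>i + m i\<close> weakly
  decrease while the parts are positive, which is closure to the left. Closure downwards holds
  because columns are initial runs.\<close>

lemma order_ideal_of_parts:
  assumes "strict_parts a m"
  shows "order_ideal (La a) Lle (ideal_of_parts m)"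
proof -
  have "(i', j') \<in> ideal_of_parts m"
    if "(i, j) \<in> ideal_of_parts m" "(i', j') \<in> La a" "i' \<le> i" "j' \<le> j" for i j i' j'
    using strict_parts_decr[OF assms, of i' "i - i'"] that
    by (auto simp: ideal_of_parts_def La_def)
  moreover have "ideal_of_parts m \<subseteq> La a"
    using strict_parts_bound[OF assms] by (fastforce simp: ideal_of_parts_def La_def)
  ultimately show ?thesis
    unfolding order_ideal_def Lle_def by fastforce
qed

lemma column_ideal_of_parts:
  assumes "strict_parts a m"
  shows "column a i \<inter> ideal_of_parts m = (if i = 0 then {} else Pair i ` {i..<i + m i})"
  using strict_parts_bound[OF assms, of i]
  by (cases "i = 0") (auto simp: column_def ideal_of_parts_def)

lemma card_column_ideal_of_parts:
  assumes "strict_parts a m"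
  shows "card (column a i \<inter> ideal_of_parts m) = m i"
  using assms
  by (auto simp: column_ideal_of_parts strict_parts_def card_image inj_on_def)

text \<open>Down-closure makes every column an initial run, so its size determines it. With
  \<open>order_ideal_of_parts\<close> this identifies order ideals with strict partitions.\<close>

lemma ideal_of_parts_card_columns:
  assumes "I \<in> JL a"
  shows "ideal_of_parts (\<lambda>i. card (column a i \<inter> I)) = I" (is "ideal_of_parts ?m = I")
    and "strict_parts a (\<lambda>i. card (column a i \<inter> I))"
proof -
  have sub: "I \<subseteq> La a"
    using assms by (auto simp: JL_def ideals_def order_ideal_def)
  have down: "(i', j') \<in> I" if "(i, j) \<in> I" "(i', j') \<in> La a" "i' \<le> i" "j' \<le> j" for i j i' j'
    using assms that by (fastforce simp: JL_def ideals_def order_ideal_def Lle_def)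
  have col: "\<exists>k. column a i \<inter> I = Pair i ` {i..<i + k}" if "1 \<le> i" for i
  proof (cases "\<exists>j. (i, j) \<in> I")
    case True
    define M where "M = Max {j. (i, j) \<in> I}"
    have fin: "finite {j. (i, j) \<in> I}"
      by (rule finite_subset[of _ "{..a}"]) (use sub in \<open>auto simp: La_def\<close>)
    have M: "(i, M) \<in> I" using Max_in[OF fin] True by (auto simp: M_def)
    have ge: "j \<le> M" if "(i, j) \<in> I" for j using Max_ge[OF fin] that by (auto simp: M_def)
    have "i \<le> M" "M \<le> a" using M sub by (auto simp: La_def)
    moreover have "(i, j) \<in> I" if "i \<le> j" "j \<le> M" for j
      using down[OF M, of i j] that \<open>1 \<le> i\<close> \<open>M \<le> a\<close> by (auto simp: La_def)
    ultimately have "column a i \<inter> I = Pair i ` {i..<i + (Suc M - i)}"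
      using ge by (force simp: column_def)
    then show ?thesis by blast
  next
    case False
    then have "column a i \<inter> I = Pair i ` {i..<i + 0}" by (auto simp: column_def)
    then show ?thesis by blast
  qed
  have col: "column a i \<inter> I = Pair i ` {i..<i + ?m i}" if "1 \<le> i" for i
  proof -
    obtain k where k: "column a i \<inter> I = Pair i ` {i..<i + k}" using col \<open>1 \<le> i\<close> by blast
    then have "?m i = k" by (simp add: card_image inj_on_def)
    then show ?thesis using k by simp
  qed
  have mem: "(i, j) \<in> I \<longleftrightarrow> i \<le> j \<and> j < i + ?m i" if "1 \<le> i" for i j
  proof -
    have "(i, j) \<in> I \<longleftrightarrow> (i, j) \<in> column a i \<inter> I"
      using sub by (auto simp: column_def La_def)
    also have "\<dots> \<longleftrightarrow> i \<le> j \<and> j < i + ?m i"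
      by (subst col[OF that]) auto
    finally show ?thesis .
  qed
  have pos: "1 \<le> i" if "(i, j) \<in> I" for i j
    using sub that by (auto simp: La_def)
  show "ideal_of_parts ?m = I"
    using mem pos by (auto simp: ideal_of_parts_def)
  have "?m 0 = 0"
  proof -
    have "column a 0 \<inter> I = {}" using pos by (force simp: column_def)
    then show ?thesis by simp
  qed
  moreover have "?m i = 0" if "i > a" for i
  proof -
    have "column a i = {}" using that by (auto simp: column_def)
    then show ?thesis by simp
  qed
  moreover have "?m 1 \<le> a"
  proof -
    have "column a 1 = Pair 1 ` {1..a}" by (auto simp: column_def)
    then have "card (column a 1) = a" "finite (column a 1)"
      by (simp_all add: card_image inj_on_def)
    then show ?thesis using card_mono[of "column a 1" "column a 1 \<inter> I"] by auto
  qed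
  moreover have "?m (Suc i) = 0 \<or> ?m (Suc i) < ?m i" if i: "i \<ge> 1" for i
  proof (cases "?m (Suc i) = 0")
    case False
    \<comment> \<open>Column \<open>Suc i\<close> starts one higher than column \<open>i\<close>, so
      its top cell has height \<open>i + ?m (Suc i)\<close>. The cell to the left of it forces
      column \<open>i\<close> to be strictly longer.\<close>
    have top: "(Suc i, i + ?m (Suc i)) \<in> I"
      using mem[of "Suc i" "i + ?m (Suc i)"] False by linarith
    then have "i + ?m (Suc i) \<le> a" using sub by (auto simp: La_def)
    then have "(i, i + ?m (Suc i)) \<in> I"
      using down[OF top, of i "i + ?m (Suc i)"] i by (simp add: La_def)
    then show ?thesis using mem[OF i, of "i + ?m (Suc i)"] by linarith
  qed blast
  ultimately show "strict_parts a ?m"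
    unfolding strict_parts_def by blast
qed

lemma JL_cases:
  assumes "I \<in> JL a"
  obtains m where "strict_parts a m" "I = ideal_of_parts m"
  by (rule that[OF ideal_of_parts_card_columns(2)[OF assms]
        ideal_of_parts_card_columns(1)[OF assms, symmetric]])

section \<open>Toggling a column\<close>

text \<open>Adding the cell of rank \<open>k\<close>, counted from 0, is blocked by a missing cell
  below or to the left; removing it is blocked by a present cell above or to the right. The left
  cell accounts for \<open>part_max\<close>, the right one for \<open>part_min\<close>.\<close>

lemma toggle_ideal_of_parts:
  assumes m: "strict_parts a m" and c: "1 \<le> c" "c + k \<le> a"
  shows "toggle (La a) Lle (c, c + k) (ideal_of_parts m) = ideal_of_parts (m(c :=
    (if m c = k \<and> k < part_max a m c then Suc k
     else if m c = Suc k \<and> part_min m c \<le> k then k else m c)))"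
proof -
  let ?I = "ideal_of_parts m" and ?x = "(c, c + k)"
  have mem: "?x \<in> ?I \<longleftrightarrow> k < m c" using c by (auto simp: ideal_of_parts_def)
  have ins: "insert ?x ?I = ideal_of_parts (m(c := Suc k))" if "m c = k"
    using that c by (auto simp: ideal_of_parts_def split: if_splits)
  have del: "?I - {?x} = ideal_of_parts (m(c := k))" if "m c = Suc k"
    using that c by (auto simp: ideal_of_parts_def split: if_splits)
  note mm = part_max_min[OF m c(1)]
  have add: "order_ideal (La a) Lle (insert ?x ?I) \<longleftrightarrow> m c = k \<and> k < part_max a m c"
    if "m c \<le> k"
  proof
    assume "order_ideal (La a) Lle (insert ?x ?I)"
    then have down: "y \<in> insert ?x ?I" if "y \<in> La a" "Lle y ?x" for y
      using that by (auto simp: order_ideal_def)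
    have "m c = k"
    proof (rule ccontr)
      assume "m c \<noteq> k"
      with \<open>m c \<le> k\<close> have "k > 0" by simp
      then have "(c, c + k - 1) \<in> La a" "Lle (c, c + k - 1) ?x"
        using c by (auto simp: La_def Lle_def)
      then have "(c, c + k - 1) \<in> insert ?x ?I" by (rule down)
      with \<open>k > 0\<close> show False using \<open>m c \<le> k\<close> \<open>m c \<noteq> k\<close> by (auto simp: ideal_of_parts_def)
    qed
    moreover have "k < part_max a m c"
    proof (cases "c = 1")
      case True
      then show ?thesis using c by (simp add: part_max_def)
    next
      case False
      then have "(c - 1, c + k) \<in> La a" "Lle (c - 1, c + k) ?x"
        using c by (auto simp: La_def Lle_def)
      then have "(c - 1, c + k) \<in> insert ?x ?I" by (rule down)
      then show ?thesis using False c by (auto simp: ideal_of_parts_def part_max_def)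
    qed
    ultimately show "m c = k \<and> k < part_max a m c" ..
  next
    assume *: "m c = k \<and> k < part_max a m c"
    then have "strict_parts a (m(c := Suc k))"
      using mm(2) c by (intro strict_parts_update[OF m c(1)]) auto
    then show "order_ideal (La a) Lle (insert ?x ?I)"
      using * ins order_ideal_of_parts by metis
  qed
  have rem: "order_ideal (La a) Lle (?I - {?x}) \<longleftrightarrow> m c = Suc k \<and> part_min m c \<le> k"
    if "k < m c"
  proof
    assume id: "order_ideal (La a) Lle (?I - {?x})"
    have "?x \<in> La a" using c by (auto simp: La_def)
    then have up: "y \<notin> ?I" if "y \<noteq> ?x" "Lle ?x y" for y
      using id that unfolding order_ideal_def by blast
    have "m c = Suc k"
    proof (rule ccontr)
      assume "m c \<noteq> Suc k"
      then show False
        using \<open>k < m c\<close> up[of "(c, c + Suc k)"] c by (auto simp: ideal_of_parts_def Lle_def)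
    qed
    moreover have "part_min m c \<le> k"
    proof (rule ccontr)
      assume "\<not> part_min m c \<le> k"
      then have "0 < m (Suc c)" "k \<le> m (Suc c)" by (auto simp: part_min_def split: if_splits)
      \<comment> \<open>For \<open>k = 0\<close> the cell to the right, \<open>(Suc c, c)\<close>,
        is below the diagonal; \<open>max 1 k\<close> then selects the diagonal cell
        \<open>(Suc c, Suc c)\<close>.\<close>
      then show False
        using up[of "(Suc c, c + max 1 k)"] by (auto simp: ideal_of_parts_def Lle_def)
    qed
    ultimately show "m c = Suc k \<and> part_min m c \<le> k" ..
  next
    assume *: "m c = Suc k \<and> part_min m c \<le> k"
    then have "strict_parts a (m(c := k))"
      using mm(1) c by (intro strict_parts_update[OF m c(1)]) auto
    then show "order_ideal (La a) Lle (?I - {?x})"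
      using * del order_ideal_of_parts by metis
  qed
  show ?thesis
  proof (cases "k < m c")
    case True
    then show ?thesis using rem mem del by (auto simp: toggle_def)
  next
    case False
    then show ?thesis using add mem ins by (auto simp: toggle_def)
  qed
qed

lemma part_max_update [simp]: "part_max a (m(c := v)) c = part_max a m c"
  if "1 \<le> c" using that by (auto simp: part_max_def)

lemma part_min_update [simp]: "part_min (m(c := v)) c = part_min m c"
  by (auto simp: part_min_def)

lemma whirl_bounds:
  assumes "strict_parts a m" "1 \<le> c" "c \<le> a"
  shows "part_min m c \<le> whirl a m c" "whirl a m c \<le> part_max a m c"
  using part_max_min[OF assms] by (auto simp: whirl_def)

lemma strict_parts_whirl:
  assumes "strict_parts a m" "1 \<le> c" "c \<le> a"
  shows "strict_parts a (m(c := whirl a m c))"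
  using assms strict_parts_update whirl_bounds by blast

text \<open>The column is toggled from the top down. If there is room, the lowest vacant cell gets
  filled and then protects all cells below it from removal. Otherwise cells are removed from the top
  until \<open>part_min\<close> is reached.\<close>

lemma col_toggle_ideal_of_parts:
  assumes m: "strict_parts a m" and c: "1 \<le> c" "c \<le> a"
  shows "col_toggle a c (ideal_of_parts m) = ideal_of_parts (m(c := whirl a m c))"
proof -
  note mm = part_max_min[OF m c]
  \<comment> \<open>The value of the part after the elements of rank above \<open>k\<close> in the column have been toggled.\<close>
  define v where "v k = (if m c < part_max a m c then (if k \<le> m c then Suc (m c) else m c)
     else if k < part_min m c then part_min m c else if k \<le> m c then k else m c)" for k
  have v_bounds: "part_min m c \<le> v k \<and> v k \<le> part_max a m c" for k
    using mm by (auto simp: v_def)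
  have part: "chain_toggle (La a) Lle (map (Pair c) [c + k..<Suc a]) (ideal_of_parts m)
      = ideal_of_parts (m(c := v k))" if "c + k \<le> Suc a" for k
    using that
  proof (induction "Suc a - (c + k)" arbitrary: k)
    case 0
    then have k: "c + k = Suc a" by simp
    \<comment> \<open>No cell has been toggled yet, and \<open>k\<close> is the full height of
      column \<open>c\<close>. No admissible value exceeds it, so \<open>v k\<close> is the original
      part.\<close>
    have "part_max a m c \<le> k"
    proof (cases "c = 1")
      case False
      then have "1 \<le> c - 1" using c by simp
      then have "m (c - 1) = 0 \<or> m (c - 1) + (c - 1) \<le> Suc a" by (rule strict_parts_bound[OF m])
      then show ?thesis using k \<open>1 \<le> c - 1\<close> by (auto simp: part_max_def)
    qed (use k in \<open>simp add: part_max_def\<close>)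
    then have "v k = m c" using mm by (auto simp: v_def)
    then show ?case by (simp add: k)
  next
    case (Suc d)
    then have k: "c + k \<le> a" "c + k < Suc a" by auto
    have IH: "chain_toggle (La a) Lle (map (Pair c) [c + Suc k..<Suc a]) (ideal_of_parts m)
      = ideal_of_parts (m(c := v (Suc k)))"
      using Suc by (intro Suc.hyps(1)) auto
    have sp: "strict_parts a (m(c := v (Suc k)))"
      using strict_parts_update[OF m c] v_bounds by blast
    have "chain_toggle (La a) Lle (map (Pair c) [c + k..<Suc a]) (ideal_of_parts m)
      = toggle (La a) Lle (c, c + k) (ideal_of_parts (m(c := v (Suc k))))"
      using IH k by (subst upt_conv_Cons) auto
    also have "\<dots> = ideal_of_parts (m(c := v k))"
    proof -
      have "(if v (Suc k) = k \<and> k < part_max a m c then Suc k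
        else if v (Suc k) = Suc k \<and> part_min m c \<le> k then k else v (Suc k)) = v k"
        using mm by (auto simp: v_def)
      then show ?thesis
        by (simp only: toggle_ideal_of_parts[OF sp c(1) k(1)] part_max_update[OF c(1)]
            part_min_update fun_upd_same fun_upd_upd)
    qed
    finally show ?case .
  qed
  have "v 0 = whirl a m c" using mm by (auto simp: v_def whirl_def)
  then show ?thesis
    using part[of 0] c by (simp add: col_toggle_def column_list_def)
qed

text \<open>\<open>whirl a m c\<close> reads only the parts \<open>c - 1\<close>, \<open>c\<close>
  and \<open>c + 1\<close>, so columns with a gap between them do not see each other's
  update.\<close>

lemma col_toggle_commute:
  assumes "I \<in> JL a" "1 \<le> c" "c \<le> a" "1 \<le> d" "d \<le> a" "Suc c < d"
  shows "col_toggle a c (col_toggle a d I) = col_toggle a d (col_toggle a c I)"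
proof -
  obtain m where m: "strict_parts a m" "I = ideal_of_parts m"
    using JL_cases assms(1) by blast
  have "whirl a (m(d := v)) c = whirl a m c" "whirl a (m(c := v)) d = whirl a m d" for v
    using assms by (auto simp: whirl_def part_max_def part_min_def)
  then show ?thesis
    using m assms by (simp add: col_toggle_ideal_of_parts strict_parts_whirl fun_upd_twist)
qed

section \<open>Sweeps\<close>

text \<open>Lists are in order of time: the first column listed is toggled first.\<close>

abbreviation sweep :: "nat \<Rightarrow> nat list \<Rightarrow> (nat \<times> nat) set \<Rightarrow> (nat \<times> nat) set" where
  "sweep a cs \<equiv> fold (col_toggle a) cs"

lemma comotion_eq_sweep: "comotion a \<nu> = sweep a (map \<nu> [1..<Suc a])"
proof -
  have "foldr (\<lambda>k f. col_toggle a (\<nu> k) \<circ> f) (rev ks) id = sweep a (map \<nu> ks)" for ks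
    by (induction ks rule: rev_induct) (auto simp: fun_eq_iff)
  then show ?thesis by (simp add: comotion_def)
qed

lemma bij_betw_sweep: "bij_betw (sweep a cs) (JL a) (JL a)"
proof (induction cs rule: rev_induct)
  case Nil
  show ?case using bij_betw_id by (simp add: id_def)
next
  case (snoc c cs)
  have "sweep a (cs @ [c]) = col_toggle a c \<circ> sweep a cs" by (simp add: fun_eq_iff)
  then show ?case using bij_betw_trans[OF snoc bij_betw_col_toggle] by (simp only:)
qed

lemma sweep_in_JL: "I \<in> JL a \<Longrightarrow> sweep a cs I \<in> JL a"
  by (rule bij_betw_apply[OF bij_betw_sweep])

lemma card_column_col_toggle:
  assumes "I \<in> JL a" "1 \<le> c" "c \<le> a" "i \<noteq> c"
  shows "card (column a i \<inter> col_toggle a c I) = card (column a i \<inter> I)"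
proof -
  obtain m where "strict_parts a m" "I = ideal_of_parts m"
    using JL_cases assms(1) by blast
  then show ?thesis
    using assms by (simp add: col_toggle_ideal_of_parts card_column_ideal_of_parts strict_parts_whirl)
qed

lemma card_column_sweep:
  assumes "I \<in> JL a" "set cs \<subseteq> {1..a}" "i \<notin> set cs"
  shows "card (column a i \<inter> sweep a cs I) = card (column a i \<inter> I)"
  using assms(2,3)
proof (induction cs rule: rev_induct)
  case (snoc c cs)
  then show ?case
    using card_column_col_toggle[OF sweep_in_JL[OF assms(1)]] by simp
qed simp

text \<open>Since \<open>k + 1\<close> is in neither list, no column of \<open>xs\<close> neighbours
  one of \<open>ys\<close>; the columns of \<open>xs\<close> are moved past \<open>ys\<close> one at
  a time.\<close>

lemma sweep_append_commute:
  assumes "I \<in> JL a" "set xs \<subseteq> {1..k}" "set ys \<subseteq> {k + 2..a}"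
  shows "sweep a (xs @ ys) I = sweep a (ys @ xs) I"
proof -
  have one: "col_toggle a x (sweep a ys I) = sweep a ys (col_toggle a x I)"
    if "I \<in> JL a" "x \<in> {1..k}" "set ys \<subseteq> {k + 2..a}" for x ys I
    using that(3)
  proof (induction ys rule: rev_induct)
    case (snoc y ys)
    then show ?case
      using that(2) col_toggle_commute[OF sweep_in_JL[OF that(1)], of x y ys] by auto
  qed simp
  show ?thesis
    using assms(1,2)
  proof (induction xs arbitrary: I)
    case (Cons x xs)
    have "col_toggle a x I \<in> JL a" using Cons.prems sweep_in_JL[of I a "[x]"] by simp
    then show ?case using Cons one[of I x ys] assms(3) by simp
  qed simp
qed

section \<open>Orbit averages and orbit sizes under rotation of a sweep\<close>

lemma s_stat_eq_sum:
  "s_stat a j I = (\<Sum>i\<in>{1..a}. of_bool (card (column a i \<inter> I) = j))"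
proof -
  have "{1..a} \<inter> {i. card (column a i \<inter> I) = j} = {i \<in> {1..a}. card (column a i \<inter> I) = j}"
    by blast
  then show ?thesis by (simp add: s_stat_def sum.If_cases of_bool_def)
qed

text \<open>The distribution of each single column size over an orbit does not depend on whether the
  orbit is observed before or after the block \<open>us\<close>.\<close>
lemma orbit_average_rotate:
  assumes "I \<in> JL a" "set us \<subseteq> {1..a}" "set vs \<subseteq> {1..a}" "set us \<inter> set vs = {}"
  shows "orbit_average (sweep a (vs @ us)) (s_stat a j) (sweep a us I)
    = orbit_average (sweep a (us @ vs)) (s_stat a j) I"
proof -
  let ?T = "sweep a (us @ vs)" and ?u = "sweep a us"
  let ?O = "orbit_of ?T I"
  note orb = finite_orbit_of[OF bij_betw_sweep finite_JL assms(1), of "us @ vs"]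
  \<comment> \<open>The sweep of \<open>us\<close> conjugates: \<open>us @ vs\<close> followed by
    \<open>us\<close> is the same as \<open>us\<close> followed by \<open>vs @ us\<close>.\<close>
  have conj: "orbit_of (sweep a (vs @ us)) (?u I) = ?u ` ?O"
    by (rule orbit_of_conjugate[of "JL a"]) (use assms(1) in \<open>auto simp: sweep_in_JL\<close>)
  have inj: "inj_on ?u ?O"
    using bij_betw_sweep orb(1) by (meson bij_betw_imp_inj_on inj_on_subset)
  \<comment> \<open>A column in \<open>us\<close> is untouched by \<open>vs\<close>, so its size
    after \<open>us\<close> is already that after the full round, and summing over the orbit absorbs
    the round. Any other column is untouched by \<open>us\<close>.\<close>
  have col: "(\<Sum>J\<in>?O. of_bool (card (column a i \<inter> ?u J) = j)) =
      (\<Sum>J\<in>?O. of_bool (card (column a i \<inter> J) = j) :: real)" for i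
  proof (cases "i \<in> set us")
    case True
    then have "i \<notin> set vs" using assms(4) by blast
    then have "(\<Sum>J\<in>?O. of_bool (card (column a i \<inter> ?u J) = j)) =
      (\<Sum>J\<in>?O. of_bool (card (column a i \<inter> ?T J) = j) :: real)"
      using orb(1) assms(3) by (intro sum.cong) (auto simp: card_column_sweep sweep_in_JL subset_iff)
    also have "\<dots> = (\<Sum>J\<in>?O. of_bool (card (column a i \<inter> J) = j))"
      by (rule sum_orbit_of_shift[OF bij_betw_sweep finite_JL assms(1)])
    finally show ?thesis .
  next
    case False
    then show ?thesis
      using orb(1) assms(2) by (intro sum.cong) (auto simp: card_column_sweep subset_iff)
  qed
  have "(\<Sum>J\<in>?u ` ?O. s_stat a j J) = (\<Sum>J\<in>?O. s_stat a j (?u J))"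
    using inj by (simp add: sum.reindex)
  also have "\<dots> = (\<Sum>J\<in>?O. s_stat a j J)"
    unfolding s_stat_eq_sum sum.swap[of _ "{1..a}" ?O] col ..
  finally show ?thesis
    unfolding orbit_average_def conj using card_image[OF inj] by simp
qed

lemma orbit_structure_rotate:
  "orbit_structure (JL a) (sweep a (vs @ us)) = orbit_structure (JL a) (sweep a (us @ vs))"
  by (rule orbit_structure_conjugate[OF finite_JL _ bij_betw_sweep[of a us]])
    (auto simp: sweep_in_JL)

section \<open>Reduction of every column order to the left-to-right order\<close>

lemma orbit_of_cong:
  assumes "\<And>y. y \<in> S \<Longrightarrow> f y = g y" "\<And>y. y \<in> S \<Longrightarrow> f y \<in> S" "x \<in> S"
  shows "orbit_of f x = orbit_of g x"
  using orbit_of_conjugate[where h = "\<lambda>x. x", OF assms(2) assms(1)[symmetric] assms(3)] by simp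

text \<open>Bundles both invariants, so that one equality transports orbit sizes and homomesy
  constants together. Storing the constants as a relation avoids matching up individual
  orbits.\<close>

definition orbit_data :: "nat \<Rightarrow> nat list \<Rightarrow> nat multiset \<times> (nat \<times> real) set" where
  "orbit_data a cs = (orbit_structure (JL a) (sweep a cs),
     {(j, r). \<forall>I\<in>JL a. orbit_average (sweep a cs) (s_stat a j) I = r})"

text \<open>Averages correspond along \<open>sweep a us\<close>; as this map is onto
  \<open>JL a\<close>, a constant valid on all orbits of one sweep is valid on all orbits of the
  other.\<close>

lemma orbit_data_rotate:
  assumes "set us \<subseteq> {1..a}" "set vs \<subseteq> {1..a}" "set us \<inter> set vs = {}"
  shows "orbit_data a (us @ vs) = orbit_data a (vs @ us)"
proof -
  have "(\<forall>I\<in>JL a. orbit_average (sweep a (us @ vs)) (s_stat a j) I = r) \<longleftrightarrow>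
    (\<forall>I\<in>JL a. orbit_average (sweep a (vs @ us)) (s_stat a j) I = r)" (is "?L \<longleftrightarrow> ?R") for j r
  proof -
    have "?L \<longleftrightarrow> (\<forall>I\<in>JL a. orbit_average (sweep a (vs @ us)) (s_stat a j) (sweep a us I) = r)"
      by (rule ball_cong) (simp_all only: orbit_average_rotate[OF _ assms])
    also have "\<dots> \<longleftrightarrow>
        (\<forall>I\<in>sweep a us ` JL a. orbit_average (sweep a (vs @ us)) (s_stat a j) I = r)"
      by blast
    finally show ?thesis
      unfolding bij_betw_imp_surj_on[OF bij_betw_sweep] .
  qed
  then show ?thesis
    unfolding orbit_data_def by (simp only: orbit_structure_rotate[of a us vs])
qed

lemma orbit_data_cong:
  assumes "\<And>I. I \<in> JL a \<Longrightarrow> sweep a xs I = sweep a ys I"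
  shows "orbit_data a xs = orbit_data a ys"
proof -
  have "orbit_of (sweep a xs) I = orbit_of (sweep a ys) I" if "I \<in> JL a" for I
    by (rule orbit_of_cong[OF assms sweep_in_JL that])
  then show ?thesis
    by (simp add: orbit_data_def orbit_structure_def orbit_average_def cong: image_cong)
qed

text \<open>Once a sweep starts with \<open>1, \<dots>, k\<close>, the columns listed between \<open>k\<close> and \<open>k + 1\<close> can be
  commuted to the front and then rotated to the end.\<close>
lemma orbit_data_prefix:
  assumes "distinct xs" "set xs = {1..a}" "k \<le> a"
  shows "\<exists>zs. orbit_data a xs = orbit_data a ([1..<Suc k] @ zs) \<and> distinct zs \<and> set zs = {Suc k..a}"
  using assms(3)
proof (induction k)
  case 0
  show ?case using assms by (intro exI[of _ xs]) simp
next
  case (Suc k)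
  then obtain zs where zs: "orbit_data a xs = orbit_data a ([1..<Suc k] @ zs)" "distinct zs"
    "set zs = {Suc k..a}" by auto
  then obtain us vs where split: "zs = us @ Suc k # vs"
    using Suc.prems by (metis atLeastAtMost_iff le_refl split_list)
  \<comment> \<open>Distinctness keeps \<open>k + 1\<close> out of \<open>us\<close> and
    \<open>vs\<close>, leaving the gap that lets \<open>us\<close> commute with
    \<open>1, ..., k\<close>.\<close>
  have sets: "set us \<subseteq> {k + 2..a}" "set vs \<subseteq> {k + 2..a}" "set us \<inter> set vs = {}"
    "set (vs @ us) = {Suc (Suc k)..a}"
  proof -
    have "set (vs @ us) = {Suc k..a} - {Suc k}" using zs split by auto
    also have "\<dots> = {Suc (Suc k)..a}" by auto
    finally show "set (vs @ us) = {Suc (Suc k)..a}" .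
    then show "set us \<subseteq> {k + 2..a}" "set vs \<subseteq> {k + 2..a}" by auto
    show "set us \<inter> set vs = {}" using zs split by auto
  qed
  let ?p = "[1..<Suc k]" and ?q = "[1..<Suc (Suc k)]"
  have "orbit_data a (?p @ zs) = orbit_data a (us @ (?q @ vs))"
  proof (rule orbit_data_cong)
    fix I assume I: "I \<in> JL a"
    have "sweep a (?p @ us) I = sweep a (us @ ?p) I"
      using I sets(1) by (intro sweep_append_commute) auto
    then show "sweep a (?p @ zs) I = sweep a (us @ (?q @ vs)) I"
      by (simp add: split)
  qed
  moreover have "orbit_data a (us @ (?q @ vs)) = orbit_data a ((?q @ vs) @ us)"
    using sets Suc.prems by (intro orbit_data_rotate) (auto simp: subset_iff)
  ultimately have "orbit_data a xs = orbit_data a (?q @ (vs @ us))"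
    using zs(1) by (simp only: append.assoc)
  moreover have "distinct (vs @ us)" using zs(2) split by auto
  ultimately show ?case using sets(4) by blast
qed

text \<open>The case \<open>k = a\<close> of \<open>orbit_data_prefix\<close>, where no column is
  left to sort.\<close>

lemma orbit_data_comotion:
  assumes "\<nu> permutes {1..a}"
  shows "orbit_data a (map \<nu> [1..<Suc a]) = orbit_data a [1..<Suc a]"
proof -
  have inj: "inj_on \<nu> (set [1..<Suc a])" by (rule permutes_inj_on[OF assms])
  have "distinct (map \<nu> [1..<Suc a])"
    by (rule distinct_map[THEN iffD2]) (intro conjI distinct_upt inj)
  moreover have "set (map \<nu> [1..<Suc a]) = {1..a}"
    unfolding set_map set_upt atLeastLessThanSuc_atLeastAtMost by (rule permutes_image[OF assms])
  ultimately obtain zs where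
    zs: "orbit_data a (map \<nu> [1..<Suc a]) = orbit_data a ([1..<Suc a] @ zs)" "set zs = {Suc a..a}"
    using orbit_data_prefix by blast
  have "zs = []" using zs(2) by simp
  then show ?thesis using zs(1) by (simp only: append_Nil2)
qed

section \<open>The sweep from left to right\<close>

text \<open>The outcome of one left-to-right sweep. If \<open>a\<close> is not a part, all positive
  parts grow by 1 and the first zero becomes 1. If it is, it is dropped and the remaining positive
  parts grow by 1 and move one index down.\<close>

definition shift_parts :: "nat \<Rightarrow> (nat \<Rightarrow> nat) \<Rightarrow> nat \<Rightarrow> nat" where
  "shift_parts a m i =
     (if m 1 < a then (if i = 1 \<or> 0 < m (i - 1) then Suc (m i) else 0) else part_min m i)"

text \<open>\<open>n k\<close> is the state after \<open>k\<close> columns, so column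
  \<open>k + 1\<close> sees an updated left and an old right neighbour. Whether the first column has
  room decides the behaviour of all later ones.\<close>

lemma sweep_left_to_right:
  assumes m: "strict_parts a m" and "k \<le> a"
  defines "n \<equiv> \<lambda>k i. if 1 \<le> i \<and> i \<le> k then shift_parts a m i else m i"
  shows "sweep a [1..<Suc k] (ideal_of_parts m) = ideal_of_parts (n k) \<and> strict_parts a (n k)"
  using \<open>k \<le> a\<close>
proof (induction k)
  case 0
  have "n 0 = m" by (auto simp: n_def)
  then show ?case using m by simp
next
  case (Suc k)
  then have IH: "sweep a [1..<Suc k] (ideal_of_parts m) = ideal_of_parts (n k)"
    "strict_parts a (n k)" by auto
  have decr: "m (Suc i) = 0 \<or> m (Suc i) < m i" if "1 \<le> i" for i
    using m that by (simp add: strict_parts_def)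
  have m1: "m 1 \<le> a" using m by (simp add: strict_parts_def)
  have "whirl a (n k) (Suc k) = shift_parts a m (Suc k)"
  proof (cases "k = 0")
    case True
    then show ?thesis using m1
      by (auto simp: whirl_def part_max_def part_min_def shift_parts_def n_def)
  next
    case False
    have vals: "n k (Suc k) = m (Suc k)" "n k (Suc (Suc k)) = m (Suc (Suc k))"
      "part_min (n k) (Suc k) = part_min m (Suc k)"
      "part_max a (n k) (Suc k) = shift_parts a m k - 1"
      using False by (simp_all add: n_def part_min_def part_max_def)
    show ?thesis
    proof (cases "m 1 < a")
      case True
      \<comment> \<open>Here \<open>shift_parts a m k\<close> is 0 and not \<open>Suc (m k)\<close>,
        but \<open>m k = 0\<close> as well, so subtracting 1 gives \<open>m k\<close> in either
        case.\<close>
      have "m k = 0" if "k \<noteq> 1" "m (k - 1) = 0"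
        using decr[of "k - 1"] that False by simp
      then have "part_max a (n k) (Suc k) = m k"
        using True unfolding vals shift_parts_def by auto
      moreover have "m (Suc k) = 0 \<or> m (Suc k) < m k"
        "m (Suc (Suc k)) = 0 \<or> m (Suc (Suc k)) < m (Suc k)"
        using decr[of k] decr[of "Suc k"] False by auto
      ultimately show ?thesis
        using True False by (auto simp: whirl_def vals(1-3) part_min_def shift_parts_def)
    next
      case full: False
      \<comment> \<open>The left neighbour was reset to just above \<open>m (Suc k)\<close>, or to
        0, so column \<open>k + 1\<close> has no room and is reset too.\<close>
      then have "part_max a (n k) (Suc k) = m (Suc k)"
        unfolding vals by (simp add: shift_parts_def part_min_def)
      then show ?thesis using full by (simp add: whirl_def vals(1-3) shift_parts_def)
    qed
  qed
  moreover have "n (Suc k) = (n k)(Suc k := shift_parts a m (Suc k))"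
    by (auto simp: n_def fun_eq_iff)
  ultimately have "n (Suc k) = (n k)(Suc k := whirl a (n k) (Suc k))" by simp
  moreover have "sweep a [1..<Suc (Suc k)] I = col_toggle a (Suc k) (sweep a [1..<Suc k] I)" for I
    by simp
  ultimately show ?case
    using Suc.prems strict_parts_whirl[OF IH(2), of "Suc k"]
      col_toggle_ideal_of_parts[OF IH(2), of "Suc k"] IH(1) by (simp only:)
qed

section \<open>The statistics along the left-to-right sweep\<close>

lemma s_stat_ideal_of_parts:
  "strict_parts a m \<Longrightarrow> s_stat a j (ideal_of_parts m) = real (card {i \<in> {1..a}. m i = j})"
  by (simp add: s_stat_def card_column_ideal_of_parts)

text \<open>Both relations are read off from \<open>shift_parts\<close>: a part \<open>j < a\<close>
  becomes \<open>j + 1\<close>, and a part 1 is created exactly when \<open>a\<close> was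
  absent.\<close>

lemma s_stat_left_to_right:
  assumes "I \<in> JL a" "1 \<le> a"
  shows "1 \<le> j \<Longrightarrow> j < a \<Longrightarrow> s_stat a (Suc j) (sweep a [1..<Suc a] I) = s_stat a j I"
    and "s_stat a 1 (sweep a [1..<Suc a] I) = 1 - s_stat a a I"
proof -
  obtain m where m: "strict_parts a m" "I = ideal_of_parts m"
    using JL_cases assms(1) by blast
  define n where "n = (\<lambda>i. if 1 \<le> i \<and> i \<le> a then shift_parts a m i else m i)"
  have sw: "sweep a [1..<Suc a] I = ideal_of_parts n" "strict_parts a n"
    using sweep_left_to_right[OF m(1), of a] m(2) by (simp_all add: n_def)
  have stat: "s_stat a k (sweep a [1..<Suc a] I) = real (card {i \<in> {1..a}. shift_parts a m i = k})"
    "s_stat a k I = real (card {i \<in> {1..a}. m i = k})" for k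
  proof -
    have "{i \<in> {1..a}. n i = k} = {i \<in> {1..a}. shift_parts a m i = k}" by (auto simp: n_def)
    then show "s_stat a k (sweep a [1..<Suc a] I) = real (card {i \<in> {1..a}. shift_parts a m i = k})"
      "s_stat a k I = real (card {i \<in> {1..a}. m i = k})"
      using s_stat_ideal_of_parts m sw by simp_all
  qed
  have decr: "m (i + d) = 0 \<or> m (i + d) + d \<le> m i" if "1 \<le> i" for i d
    using strict_parts_decr[OF m(1) that] .
  have m1: "m 1 \<le> a" and ma: "m (Suc a) = 0" using m by (simp_all add: strict_parts_def)
  show "s_stat a (Suc j) (sweep a [1..<Suc a] I) = s_stat a j I" if j: "1 \<le> j" "j < a"
  proof (cases "m 1 < a")
    case True
    have pos: "i = 1 \<or> 0 < m (i - 1)" if "1 \<le> i" "m i = j" for i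
    proof (cases "i = 1")
      case False
      then have "1 \<le> i - 1" using that by simp
      then show ?thesis using decr[of "i - 1" 1] that j by simp
    qed simp
    have "shift_parts a m i = Suc j \<longleftrightarrow> m i = j" if "1 \<le> i" for i
      using True pos[OF that] by (auto simp: shift_parts_def)
    then have "{i \<in> {1..a}. shift_parts a m i = Suc j} = {i \<in> {1..a}. m i = j}" by auto
    then show ?thesis by (simp only: stat)
  next
    case False
    \<comment> \<open>Only index 1, which carries the part \<open>a\<close>, has no preimage under
      \<open>Suc\<close> here, and it is not counted since \<open>j < a\<close>.\<close>
    have "{i \<in> {1..a}. m i = j} = Suc ` {i \<in> {1..a}. shift_parts a m i = Suc j}" (is "?A = Suc ` ?B")
    proof (intro equalityI subsetI)
      fix i assume i: "i \<in> ?A"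
      then have "i \<noteq> 1" using False m1 j by auto
      then obtain i' where "i = Suc i'" "1 \<le> i'" using i by (cases i) auto
      then show "i \<in> Suc ` ?B"
        using i j False by (auto simp: shift_parts_def part_min_def)
    next
      fix i assume "i \<in> Suc ` ?B"
      then obtain i' where i': "i = Suc i'" "i' \<in> ?B" by blast
      then have "m i = j" using False by (auto simp: shift_parts_def part_min_def split: if_splits)
      moreover have "i \<le> a" using i' ma \<open>m i = j\<close> j by (cases "i' = a") auto
      ultimately show "i \<in> ?A" using i' by auto
    qed
    then show ?thesis by (simp only: stat card_image[OF inj_Suc])
  qed
  show "s_stat a 1 (sweep a [1..<Suc a] I) = 1 - s_stat a a I"
  proof (cases "m 1 < a")
    case True
    have "m i < a" if "1 \<le> i" for i
      using decr[of 1 "i - 1"] True that by auto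
    then have "{i \<in> {1..a}. m i = a} = {}" by fastforce
    then have "s_stat a a I = 0" by (simp only: stat(2)) simp
    moreover have "{i \<in> {1..a}. shift_parts a m i = 1} = {LEAST i. 1 \<le> i \<and> m i = 0}"
    proof -
      define z where "z = (LEAST i. 1 \<le> i \<and> m i = 0)"
      \<comment> \<open>With \<open>m 1 < a\<close> there are not enough values for \<open>a\<close>
        distinct positive parts, so the first zero lies within \<open>{1..a}\<close>.\<close>
      have "m a = 0" using decr[of 1 "a - 1"] True assms(2) by auto
      then have z: "1 \<le> z" "m z = 0" "z \<le> a"
        using LeastI[of "\<lambda>i. 1 \<le> i \<and> m i = 0" a] Least_le[of "\<lambda>i. 1 \<le> i \<and> m i = 0" a] assms(2)
        by (auto simp: z_def)
      have before: "0 < m i" if "1 \<le> i" "i < z" for i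
        using not_less_Least[of i "\<lambda>i. 1 \<le> i \<and> m i = 0"] that by (auto simp: z_def)
      have after: "m i = 0" if "z \<le> i" for i
        using decr[of z "i - z"] z that by auto
      have "shift_parts a m i = 1 \<longleftrightarrow> i = z" if "1 \<le> i" for i
      proof -
        have "shift_parts a m i = 1 \<longleftrightarrow> (i = 1 \<or> 0 < m (i - 1)) \<and> m i = 0"
          using True by (auto simp: shift_parts_def)
        also have "\<dots> \<longleftrightarrow> i = z"
        proof (cases i z rule: linorder_cases)
          case less
          then show ?thesis using before[of i] that by simp
        next
          case equal
          have "i = 1 \<or> 0 < m (i - 1)"
          proof (cases "i = 1")
            case False
            then have "0 < m (i - 1)" using equal z(1) by (intro before) linarith+
            then show ?thesis ..
          qed simp
          then show ?thesis using equal z(2) by simp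
        next
          case greater
          then show ?thesis using after[of "i - 1"] z(1) by simp
        qed
        finally show ?thesis .
      qed
      then show ?thesis unfolding z_def[symmetric] using z by auto
    qed
    ultimately show ?thesis by (simp only: stat(1)) simp
  next
    case False
    have "m i = a \<longleftrightarrow> i = 1" if "1 \<le> i" for i
      using decr[of 1 "i - 1"] False m1 assms(2) that by (cases "i = 1") auto
    then have "{i \<in> {1..a}. m i = a} = {1}" using assms(2) by auto
    then have "s_stat a a I = 1" by (simp only: stat(2)) simp
    \<comment> \<open>\<open>part_min\<close> is 0 or at least 2, so no part equal to 1
      arises.\<close>
    moreover have "{i \<in> {1..a}. shift_parts a m i = 1} = {}"
      using False by (auto simp: shift_parts_def part_min_def)
    ultimately show ?thesis by (simp only: stat(1)) simp
  qed
qed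

text \<open>The orbit sums \<open>S 1, ..., S a\<close> coincide by shifting, and \<open>S 1\<close>
  is the orbit size minus \<open>S a\<close>; hence each is half the orbit size.\<close>

lemma orbit_average_left_to_right:
  assumes I: "I \<in> JL a" and "j \<in> {1..a}"
  shows "orbit_average (sweep a [1..<Suc a]) (s_stat a j) I = 1 / 2"
proof -
  have a: "1 \<le> a" using assms(2) by simp
  let ?T = "sweep a [1..<Suc a]"
  let ?O = "orbit_of ?T I"
  note orb = finite_orbit_of[OF bij_betw_sweep finite_JL I, of "[1..<Suc a]"]
  note shift = sum_orbit_of_shift[OF bij_betw_sweep finite_JL I, of _ "[1..<Suc a]"]
  have mem: "J \<in> JL a" if "J \<in> ?O" for J using orb(1) that by blast
  define S where "S j = (\<Sum>J\<in>?O. s_stat a j J)" for j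
  have step_eq: "S (Suc i) = S i" if "1 \<le> i" "i < a" for i
  proof -
    have "S (Suc i) = (\<Sum>J\<in>?O. s_stat a (Suc i) (?T J))"
      unfolding S_def by (rule shift[symmetric])
    also have "\<dots> = S i"
      unfolding S_def by (intro sum.cong refl s_stat_left_to_right(1) mem a that)
    finally show ?thesis .
  qed
  have const: "S i = S 1" if "1 \<le> i" "i \<le> a" for i
    using that(1) \<open>i \<le> a\<close>
  proof (induction i rule: dec_induct)
    case (step i)
    then show ?case using step_eq[of i] by simp
  qed simp
  have "S 1 = (\<Sum>J\<in>?O. s_stat a 1 (?T J))"
    unfolding S_def by (rule shift[symmetric])
  also have "\<dots> = (\<Sum>J\<in>?O. 1 - s_stat a a J)"
    by (intro sum.cong refl s_stat_left_to_right(2) mem a)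
  also have "\<dots> = real (card ?O) - S a" by (simp add: S_def sum_subtractf)
  finally have "2 * S j = real (card ?O)" using const[of a] const[of j] assms(2) a by simp
  moreover have "0 < card ?O" using orb(2,3) by (simp add: card_gt_0_iff)
  ultimately show ?thesis
    unfolding orbit_average_def S_def[symmetric] by (simp add: field_simps)
qed

theorem mainTheorem3:
  fixes a :: nat
  assumes "a \<ge> 1"
  shows "(\<forall>\<nu> \<nu>'. \<nu> permutes {1..a} \<longrightarrow> \<nu>' permutes {1..a} \<longrightarrow>
            orbit_structure (JL a) (comotion a \<nu>) = orbit_structure (JL a) (comotion a \<nu>'))
       \<and> (\<forall>\<nu>. \<nu> permutes {1..a} \<longrightarrow>
            (\<forall>j\<in>{1..a}. homomesic (JL a) (comotion a \<nu>) (s_stat a j)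
                \<and> (\<forall>I\<in>JL a. orbit_average (comotion a \<nu>) (s_stat a j) I = 1/2))
          \<and> (\<forall>c :: nat \<Rightarrow> real. homomesic (JL a) (comotion a \<nu>)
                (\<lambda>I. \<Sum>j=1..a. c j * s_stat a j I)))"
proof -
  have avg: "orbit_average (comotion a \<nu>) (s_stat a j) I = 1/2"
    if "\<nu> permutes {1..a}" "j \<in> {1..a}" "I \<in> JL a" for \<nu> j I
  proof -
    \<comment> \<open>The constant 1/2 is carried from the left-to-right order to
      \<open>\<nu>\<close> by equality of \<open>orbit_data\<close>.\<close>
    have "(j, 1/2) \<in> snd (orbit_data a [1..<Suc a])"
      using orbit_average_left_to_right[OF _ that(2)] by (simp add: orbit_data_def del: upt_Suc)
    then have "(j, 1/2) \<in> snd (orbit_data a (map \<nu> [1..<Suc a]))"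
      unfolding orbit_data_comotion[OF that(1)] .
    then show ?thesis
      using that(3) by (simp add: orbit_data_def comotion_eq_sweep del: upt_Suc)
  qed
  have str: "orbit_structure (JL a) (comotion a \<nu>) = fst (orbit_data a [1..<Suc a])"
    if "\<nu> permutes {1..a}" for \<nu>
    unfolding orbit_data_comotion[OF that, symmetric] by (simp add: orbit_data_def comotion_eq_sweep)
  have lin: "orbit_average (comotion a \<nu>) (\<lambda>I. \<Sum>j=1..a. c j * s_stat a j I) I = (\<Sum>j=1..a. c j / 2)"
    if "\<nu> permutes {1..a}" "I \<in> JL a" for \<nu> I and c :: "nat \<Rightarrow> real"
  proof -
    have "orbit_average (comotion a \<nu>) (\<lambda>I. \<Sum>j=1..a. c j * s_stat a j I) I =
      (\<Sum>j=1..a. c j * orbit_average (comotion a \<nu>) (s_stat a j) I)"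
      unfolding orbit_average_def
      by (subst sum.swap) (simp add: sum_divide_distrib sum_distrib_left)
    then show ?thesis using avg[OF that(1) _ that(2)] by simp
  qed
  show ?thesis
  proof (intro conjI allI impI ballI)
    fix \<nu> \<nu>' :: "nat \<Rightarrow> nat" assume "\<nu> permutes {1..a}" "\<nu>' permutes {1..a}"
    then show "orbit_structure (JL a) (comotion a \<nu>) = orbit_structure (JL a) (comotion a \<nu>')"
      by (simp only: str)
  next
    fix \<nu> j assume "\<nu> permutes {1..a}" "j \<in> {1..a}"
    then show "homomesic (JL a) (comotion a \<nu>) (s_stat a j)"
      using avg unfolding homomesic_def by blast
  next
    fix \<nu> j I assume "\<nu> permutes {1..a}" "j \<in> {1..a}" "I \<in> JL a"
    then show "orbit_average (comotion a \<nu>) (s_stat a j) I = 1/2" by (rule avg)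
  next
    fix \<nu> and c :: "nat \<Rightarrow> real" assume "\<nu> permutes {1..a}"
    then show "homomesic (JL a) (comotion a \<nu>) (\<lambda>I. \<Sum>j=1..a. c j * s_stat a j I)"
      using lin unfolding homomesic_def by blast
  qed
qed

end
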